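(* Let $(M,\circ,\nabla)$ be an F-manifold with compatible connection and let $\overline X$ be an invertible vector field satisfying $$c^i_{jl}\nabla_k\overline X^l=c^i_{kl}\nabla_j\overline X^l$$ in local coordinates, where $c^i_{jk}$ are the structure constants of $\circ$. Then $(M,\circ,\overline\nabla)$, where $\overline\nabla$ is the connection defined by $$\overline\nabla_Y Z:=\overline X^{-1}\circ\nabla_Y(\overline X\circ Z)$$ for all vector fields $Y,Z$, is an F-manifold with compatible connection.
   Context: "Vector field" means smooth local vector field; summation over repeated indices is understood. The Riemann tensor of a connection $\nabla$ is $R(X,Y)Z=\nabla_X\nabla_YZ-\nabla_Y\nabla_XZ-\nabla_{[X,Y]}Z$. F-manifold with compatible connection: a smooth manifold $M$ with a commutative associative $C^\infty$-bilinear product $\circ$ on vector fields and a connection $\nabla$ such that (i) $\nabla$ is torsionless and compatible with the product, i.e. writing $c(X,Y)=X\circ Y$, the expression $(\nabla_X c)(Y,Z)$ is symmetric in $X,Y,Z$; (ii) the Riemann tensor $R$ of $\nabla$ satisfies $R(Y,Z)(X\circ W)+R(X,Y)(Z\circ W)+R(Z,X)(Y\circ W)=0$ for all vector fields $X,Y,Z,W$. Invertible vector field: a vector field $\overline X$ is invertible if the product has a unit vector field $e$ ($e\circ Y=Y$ for all $Y$) and there is a vector field $\overline X^{-1}$ with $\overline X\circ\overline X^{-1}=e$. *)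

theory Defs
  imports "HOL-Analysis.Analysis" "HOL-Library.Function_Algebras"
begin

section \<open>Smooth functions on open subsets of Euclidean space\<close>

abbreviation partial_deriv :: "'n::finite \<Rightarrow> (real^'n \<Rightarrow> 'b::real_normed_vector) \<Rightarrow> real^'n \<Rightarrow> 'b"
  where "partial_deriv i f \<equiv> (\<lambda>x. frechet_derivative f (at x) (axis i 1))"

primrec Ck_on :: "nat \<Rightarrow> (real^'n::finite) set \<Rightarrow> (real^'n \<Rightarrow> 'b::real_normed_vector) \<Rightarrow> bool" where
  "Ck_on 0 S f \<longleftrightarrow> continuous_on S f"
| "Ck_on (Suc k) S f \<longleftrightarrow>
     (\<forall>x\<in>S. f differentiable (at x)) \<and> (\<forall>i. Ck_on k S (partial_deriv i f))"

definition Cinf_on :: "(real^'n::finite) set \<Rightarrow> (real^'n \<Rightarrow> 'b::real_normed_vector) \<Rightarrow> bool"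
  where "Cinf_on S f \<longleftrightarrow> (\<forall>k. Ck_on k S f)"

section \<open>Smooth manifolds\<close>

text \<open>A chart is a pair \<open>(V, \<phi>)\<close> of its domain and its coordinate map; the values of \<open>\<phi>\<close>
  outside \<open>V\<close> are irrelevant. The dimension is the cardinality of the index type.\<close>

type_synonym ('a, 'n) chart = "'a set \<times> ('a \<Rightarrow> real^'n)"

definition is_chart :: "'a topology \<Rightarrow> ('a, 'n::finite) chart \<Rightarrow> bool" where
  "is_chart T = (\<lambda>(V, \<phi>). openin T V \<and> open (\<phi> ` V) \<and>
     homeomorphic_map (subtopology T V) (top_of_set (\<phi> ` V)) \<phi>)"

definition smooth_transition :: "('a, 'n::finite) chart \<Rightarrow> ('a, 'n) chart \<Rightarrow> bool" where
  "smooth_transition = (\<lambda>(V, \<phi>) (W, \<psi>). Cinf_on (\<phi> ` (V \<inter> W)) (\<psi> \<circ> inv_into V \<phi>))"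

text \<open>The atlas \<open>A\<close> need not be maximal.\<close>

definition smooth_manifold :: "'a topology \<Rightarrow> ('a, 'n::finite) chart set \<Rightarrow> bool" where
  "smooth_manifold T A \<longleftrightarrow>
     Hausdorff_space T \<and> second_countable T \<and>
     (\<forall>c\<in>A. is_chart T c) \<and> (\<Union>c\<in>A. fst c) = topspace T \<and>
     (\<forall>c\<in>A. \<forall>d\<in>A. smooth_transition c d)"

text \<open>Elements of \<open>smooth_functions T A U\<close> are unconstrained outside \<open>U\<close>.\<close>

definition smooth_functions ::
    "'a topology \<Rightarrow> ('a, 'n::finite) chart set \<Rightarrow> 'a set \<Rightarrow> ('a \<Rightarrow> real) set" where
  "smooth_functions T A U =
     {f. openin T U \<and> (\<forall>(V, \<phi>)\<in>A. Cinf_on (\<phi> ` (U \<inter> V)) (f \<circ> inv_into V \<phi>))}"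

definition smooth_near :: "'a topology \<Rightarrow> ('a, 'n::finite) chart set \<Rightarrow> ('a \<Rightarrow> real) \<Rightarrow> 'a \<Rightarrow> bool" where
  "smooth_near T A f p \<longleftrightarrow> (\<exists>W. p \<in> W \<and> f \<in> smooth_functions T A W)"

section \<open>Local vector fields\<close>

text \<open>A tangent vector at \<open>p\<close> is the directional derivative \<open>f \<mapsto> D(f \<circ> \<phi>\<inverse>)(\<phi> p) \<xi>\<close>
  on functions that are smooth near \<open>p\<close>. It is set to \<open>0\<close> on all other functions, so that
  equality of tangent vectors is equality of HOL functions and does not depend on the chart.\<close>

definition tangent_vector ::
    "'a topology \<Rightarrow> ('a, 'n::finite) chart set \<Rightarrow> ('a, 'n) chart \<Rightarrow> 'a \<Rightarrow> real^'n \<Rightarrow> ('a \<Rightarrow> real) \<Rightarrow> real" where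
  "tangent_vector T A = (\<lambda>(V, \<phi>) p \<xi> f.
     if smooth_near T A f p then frechet_derivative (f \<circ> inv_into V \<phi>) (at (\<phi> p)) \<xi> else 0)"

definition tangent_space ::
    "'a topology \<Rightarrow> ('a, 'n::finite) chart set \<Rightarrow> 'a \<Rightarrow> (('a \<Rightarrow> real) \<Rightarrow> real) set" where
  "tangent_space T A p = {tangent_vector T A c p \<xi> | c \<xi>. c \<in> A \<and> p \<in> fst c}"

type_synonym 'a vfield = "'a \<Rightarrow> ('a \<Rightarrow> real) \<Rightarrow> real"

text \<open>The smooth vector fields on the open set \<open>U\<close>, extended by \<open>0\<close> outside \<open>U\<close>. Sums and
  differences of fields are the pointwise operations of \<^theory>\<open>HOL-Library.Function_Algebras\<close>.\<close>

definition vfields :: "'a topology \<Rightarrow> ('a, 'n::finite) chart set \<Rightarrow> 'a set \<Rightarrow> 'a vfield set" where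
  "vfields T A U = {X. (\<forall>p\<in>U. X p \<in> tangent_space T A p) \<and> (\<forall>p. p \<notin> U \<longrightarrow> X p = 0) \<and>
     (\<forall>W f. W \<subseteq> U \<longrightarrow> f \<in> smooth_functions T A W \<longrightarrow> (\<lambda>p. X p f) \<in> smooth_functions T A W)}"

definition vrestrict :: "'a vfield \<Rightarrow> 'a set \<Rightarrow> 'a vfield" (infixl "\<restriction>" 110) where
  "X \<restriction> V = (\<lambda>p. if p \<in> V then X p else 0)"

definition fscale :: "('a \<Rightarrow> real) \<Rightarrow> 'a vfield \<Rightarrow> 'a vfield" (infixr "\<cdot>\<^sub>v" 75) where
  "f \<cdot>\<^sub>v X = (\<lambda>p g. f p * X p g)"

definition vapply :: "'a vfield \<Rightarrow> ('a \<Rightarrow> real) \<Rightarrow> 'a \<Rightarrow> real" where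
  "vapply X f = (\<lambda>p. X p f)"

text \<open>The guard is needed because \<open>vapply Y f\<close> may be smooth near \<open>p\<close> although \<open>f\<close> is not.\<close>

definition lie_bracket ::
    "'a topology \<Rightarrow> ('a, 'n::finite) chart set \<Rightarrow> 'a vfield \<Rightarrow> 'a vfield \<Rightarrow> 'a vfield" where
  "lie_bracket T A X Y = (\<lambda>p f.
     if smooth_near T A f p then X p (vapply Y f) - Y p (vapply X f) else 0)"

section \<open>Products and connections\<close>

text \<open>A binary operation on local vector fields is a family indexed by the open set \<open>U\<close> on which
  the arguments are defined, compatible with restriction to smaller open sets.\<close>

type_synonym 'a vop = "'a set \<Rightarrow> 'a vfield \<Rightarrow> 'a vfield \<Rightarrow> 'a vfield"

definition local_operation ::
    "'a topology \<Rightarrow> ('a, 'n::finite) chart set \<Rightarrow> 'a vop \<Rightarrow> bool" where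
  "local_operation T A F \<longleftrightarrow>
     (\<forall>U. openin T U \<longrightarrow> (\<forall>X\<in>vfields T A U. \<forall>Y\<in>vfields T A U.
        F U X Y \<in> vfields T A U \<and>
        (\<forall>V. openin T V \<and> V \<subseteq> U \<longrightarrow> F V (X \<restriction> V) (Y \<restriction> V) = F U X Y \<restriction> V)))"

definition comm_assoc_product ::
    "'a topology \<Rightarrow> ('a, 'n::finite) chart set \<Rightarrow> 'a vop \<Rightarrow> bool" where
  "comm_assoc_product T A m \<longleftrightarrow> local_operation T A m \<and>
     (\<forall>U. openin T U \<longrightarrow>
       (\<forall>X\<in>vfields T A U. \<forall>Y\<in>vfields T A U. \<forall>Z\<in>vfields T A U. \<forall>f\<in>smooth_functions T A U.
          m U X Y = m U Y X \<and>
          m U (m U X Y) Z = m U X (m U Y Z) \<and>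
          m U (X + Y) Z = m U X Z + m U Y Z \<and>
          m U X (Y + Z) = m U X Y + m U X Z \<and>
          m U (f \<cdot>\<^sub>v X) Y = f \<cdot>\<^sub>v m U X Y \<and>
          m U X (f \<cdot>\<^sub>v Y) = f \<cdot>\<^sub>v m U X Y))"

definition connection ::
    "'a topology \<Rightarrow> ('a, 'n::finite) chart set \<Rightarrow> 'a vop \<Rightarrow> bool" where
  "connection T A nabla \<longleftrightarrow> local_operation T A nabla \<and>
     (\<forall>U. openin T U \<longrightarrow>
       (\<forall>X\<in>vfields T A U. \<forall>Y\<in>vfields T A U. \<forall>Z\<in>vfields T A U. \<forall>f\<in>smooth_functions T A U.
          nabla U (X + Y) Z = nabla U X Z + nabla U Y Z \<and>
          nabla U X (Y + Z) = nabla U X Y + nabla U X Z \<and>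
          nabla U (f \<cdot>\<^sub>v X) Y = f \<cdot>\<^sub>v nabla U X Y \<and>
          nabla U X (f \<cdot>\<^sub>v Y) = vapply X f \<cdot>\<^sub>v Y + f \<cdot>\<^sub>v nabla U X Y))"

definition torsionless ::
    "'a topology \<Rightarrow> ('a, 'n::finite) chart set \<Rightarrow> 'a vop \<Rightarrow> bool" where
  "torsionless T A nabla \<longleftrightarrow>
     (\<forall>U. openin T U \<longrightarrow> (\<forall>X\<in>vfields T A U. \<forall>Y\<in>vfields T A U.
        nabla U X Y - nabla U Y X = lie_bracket T A X Y))"

text \<open>\<open>deriv_product m nabla U X Y Z\<close> is \<open>(\<nabla>\<^sub>X c)(Y, Z)\<close> for \<open>c(Y, Z) = m U Y Z\<close>.\<close>

definition deriv_product ::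
    "'a vop \<Rightarrow> 'a vop \<Rightarrow> 'a set \<Rightarrow> 'a vfield \<Rightarrow> 'a vfield \<Rightarrow> 'a vfield \<Rightarrow> 'a vfield" where
  "deriv_product m nabla U X Y Z = nabla U X (m U Y Z) - m U (nabla U X Y) Z - m U Y (nabla U X Z)"

definition compatible_with_product ::
    "'a topology \<Rightarrow> ('a, 'n::finite) chart set \<Rightarrow> 'a vop \<Rightarrow> 'a vop \<Rightarrow> bool" where
  "compatible_with_product T A m nabla \<longleftrightarrow>
     (\<forall>U. openin T U \<longrightarrow> (\<forall>X\<in>vfields T A U. \<forall>Y\<in>vfields T A U. \<forall>Z\<in>vfields T A U.
        deriv_product m nabla U X Y Z = deriv_product m nabla U Y X Z \<and>
        deriv_product m nabla U X Y Z = deriv_product m nabla U X Z Y))"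

definition riemann ::
    "'a topology \<Rightarrow> ('a, 'n::finite) chart set \<Rightarrow> 'a vop \<Rightarrow> 'a set \<Rightarrow>
     'a vfield \<Rightarrow> 'a vfield \<Rightarrow> 'a vfield \<Rightarrow> 'a vfield" where
  "riemann T A nabla U X Y Z =
     nabla U X (nabla U Y Z) - nabla U Y (nabla U X Z) - nabla U (lie_bracket T A X Y) Z"

definition curvature_condition ::
    "'a topology \<Rightarrow> ('a, 'n::finite) chart set \<Rightarrow> 'a vop \<Rightarrow> 'a vop \<Rightarrow> bool" where
  "curvature_condition T A m nabla \<longleftrightarrow>
     (\<forall>U. openin T U \<longrightarrow>
       (\<forall>X\<in>vfields T A U. \<forall>Y\<in>vfields T A U. \<forall>Z\<in>vfields T A U. \<forall>W\<in>vfields T A U.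
          riemann T A nabla U Y Z (m U X W) + riemann T A nabla U X Y (m U Z W)
            + riemann T A nabla U Z X (m U Y W) = 0))"

definition F_manifold_compatible_connection ::
    "'a topology \<Rightarrow> ('a, 'n::finite) chart set \<Rightarrow> 'a vop \<Rightarrow> 'a vop \<Rightarrow> bool" where
  "F_manifold_compatible_connection T A m nabla \<longleftrightarrow>
     smooth_manifold T A \<and> comm_assoc_product T A m \<and> connection T A nabla \<and>
     torsionless T A nabla \<and> compatible_with_product T A m nabla \<and> curvature_condition T A m nabla"

section \<open>Invertible vector fields\<close>

definition unit_vfield ::
    "'a topology \<Rightarrow> ('a, 'n::finite) chart set \<Rightarrow> 'a vop \<Rightarrow> 'a vfield \<Rightarrow> bool" where
  "unit_vfield T A m e \<longleftrightarrow> e \<in> vfields T A (topspace T) \<and>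
     (\<forall>U. openin T U \<longrightarrow> (\<forall>Y\<in>vfields T A U. m U (e \<restriction> U) Y = Y))"

definition is_inverse_vfield ::
    "'a topology \<Rightarrow> ('a, 'n::finite) chart set \<Rightarrow> 'a vop \<Rightarrow> 'a vfield \<Rightarrow> 'a vfield \<Rightarrow> bool" where
  "is_inverse_vfield T A m X Y \<longleftrightarrow>
     Y \<in> vfields T A (topspace T) \<and> unit_vfield T A m (m (topspace T) X Y)"

definition invertible_vfield ::
    "'a topology \<Rightarrow> ('a, 'n::finite) chart set \<Rightarrow> 'a vop \<Rightarrow> 'a vfield \<Rightarrow> bool" where
  "invertible_vfield T A m X \<longleftrightarrow>
     X \<in> vfields T A (topspace T) \<and> (\<exists>Y. is_inverse_vfield T A m X Y)"

text \<open>For a commutative associative product the inverse is unique.\<close>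

definition inverse_vfield ::
    "'a topology \<Rightarrow> ('a, 'n::finite) chart set \<Rightarrow> 'a vop \<Rightarrow> 'a vfield \<Rightarrow> 'a vfield" where
  "inverse_vfield T A m X = (THE Y. is_inverse_vfield T A m X Y)"

section \<open>Local coordinates\<close>

definition coord_vfield ::
    "'a topology \<Rightarrow> ('a, 'n::finite) chart set \<Rightarrow> ('a, 'n) chart \<Rightarrow> 'n \<Rightarrow> 'a vfield" where
  "coord_vfield T A c j = (\<lambda>p. if p \<in> fst c then tangent_vector T A c p (axis j 1) else 0)"

text \<open>The \<open>i\<close>-th component of \<open>X\<close> in the chart \<open>c\<close> is \<open>X\<close> applied to the \<open>i\<close>-th coordinate function.\<close>

definition component :: "('a, 'n::finite) chart \<Rightarrow> 'a vfield \<Rightarrow> 'n \<Rightarrow> 'a \<Rightarrow> real" where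
  "component c X i = vapply X (\<lambda>q. snd c q $ i)"

definition structure_const ::
    "'a topology \<Rightarrow> ('a, 'n::finite) chart set \<Rightarrow> 'a vop \<Rightarrow> ('a, 'n) chart \<Rightarrow> 'n \<Rightarrow> 'n \<Rightarrow> 'n \<Rightarrow> 'a \<Rightarrow> real" where
  "structure_const T A m c i j k =
     component c (m (fst c) (coord_vfield T A c j) (coord_vfield T A c k)) i"

text \<open>\<open>cov_deriv_component T A nabla c X k l\<close> is \<open>\<nabla>\<^sub>k X\<^sup>l\<close>, the \<open>l\<close>-th component of \<open>\<nabla>\<^bsub>\<partial>\<^sub>k\<^esub> X\<close>.\<close>

definition cov_deriv_component ::
    "'a topology \<Rightarrow> ('a, 'n::finite) chart set \<Rightarrow> 'a vop \<Rightarrow> ('a, 'n) chart \<Rightarrow> 'a vfield \<Rightarrow>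
     'n \<Rightarrow> 'n \<Rightarrow> 'a \<Rightarrow> real" where
  "cov_deriv_component T A nabla c X k l =
     component c (nabla (fst c) (coord_vfield T A c k) (X \<restriction> fst c)) l"

definition twisted_connection ::
    "'a topology \<Rightarrow> ('a, 'n::finite) chart set \<Rightarrow> 'a vop \<Rightarrow> 'a vop \<Rightarrow> 'a vfield \<Rightarrow> 'a vop" where
  "twisted_connection T A m nabla X = (\<lambda>U Y Z.
     m U (inverse_vfield T A m X \<restriction> U) (nabla U Y (m U (X \<restriction> U) Z)))"

end

theory Submission
  imports Defs
begin

text \<open>Write \<open>P\<close> for the given invertible field and \<open>Q\<close> for its inverse. Because the product is
  function-linear in both arguments and \<open>\<nabla>\<^sub>Z P\<close> is function-linear in \<open>Z\<close>, the condition in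
  coordinates says that
  \<open>Y \<circ> \<nabla>\<^sub>Z P = Z \<circ> \<nabla>\<^sub>Y P\<close> for all local fields \<open>Y\<close>, \<open>Z\<close> (\<open>product_nabla_symmetry\<close>). Once this is
  known, the theorem is pure algebra on the vector fields over each open set, carried out in the
  locale \<open>twisting_algebra\<close>.

  The new connection is the old one conjugated by multiplication with \<open>P\<close>. Hence its curvature is
  \<open>R'(Y, Z) W = Q \<circ> R(Y, Z) (P \<circ> W)\<close>, and its cyclic curvature condition at \<open>W\<close> is the old one at
  \<open>P \<circ> W\<close> (\<open>twisted_curvature\<close>). For the torsion, expand
  \<open>\<nabla>\<^sub>Y (P \<circ> Z) = (\<nabla>\<^sub>Y c)(P, Z) + (\<nabla>\<^sub>Y P) \<circ> Z + P \<circ> \<nabla>\<^sub>Y Z\<close>: the first term is symmetric in \<open>Y\<close> and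
  \<open>Z\<close> by compatibility, the second by the condition on \<open>P\<close>, so the commutator is
  \<open>P \<circ> [Y, Z]\<close> (\<open>twisted_torsion\<close>). For compatibility, the new derivative of the product is \<open>Q\<close> times
  \<open>(\<nabla>\<^sub>Y c)(P \<circ> Z, W) - Z \<circ> (\<nabla>\<^sub>Y c)(P, W) - Z \<circ> W \<circ> \<nabla>\<^sub>Y P\<close>. The last term is symmetric in \<open>Y\<close> and \<open>Z\<close>
  by the condition on \<open>P\<close>; for the first two, total symmetry of \<open>\<nabla>c\<close> makes \<open>W\<close> the direction, and
  the claim becomes the derivative of the identity \<open>(P \<circ> Z) \<circ> Y = (P \<circ> Y) \<circ> Z\<close>
  (\<open>twisted_compatible\<close>).

  The rest of the work is in passing from coordinates to vector fields. For this the coordinate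
  fields must be smooth vector fields, which rests on the smoothness of compositions with transition
  maps (\<open>Ck_on_compose\<close>, \<open>coord_vfield_in_vfields\<close>), and they must span all fields on a chart domain,
  which rests on the chain rule for a change of chart (\<open>vfield_expansion\<close>).\<close>

section \<open>Calculus of smooth functions on open sets\<close>

lemma frechet_derivative_cong_open:
  fixes f g :: "real^'n::finite \<Rightarrow> 'b::real_normed_vector"
  assumes S: "open S" "x \<in> S" and eq: "\<And>y. y \<in> S \<Longrightarrow> f y = g y"
  shows "frechet_derivative f (at x) = frechet_derivative g (at x)"
proof -
  have "(f has_derivative D) (at x) \<longleftrightarrow> (g has_derivative D) (at x)" for D
    using has_derivative_transform_within_open[OF _ S, of f D UNIV g]
      has_derivative_transform_within_open[OF _ S, of g D UNIV f] eq by auto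
  then show ?thesis unfolding frechet_derivative_def by simp
qed

lemma differentiable_cong_open:
  fixes f g :: "real^'n::finite \<Rightarrow> 'b::real_normed_vector"
  assumes "open S" "x \<in> S" and "\<And>y. y \<in> S \<Longrightarrow> f y = g y"
  shows "f differentiable (at x) \<longleftrightarrow> g differentiable (at x)"
  unfolding differentiable_def
  using has_derivative_transform_within_open[OF _ assms(1,2), of f _ UNIV g]
    has_derivative_transform_within_open[OF _ assms(1,2), of g _ UNIV f] assms(3) by metis

lemma Ck_on_cong:
  fixes f g :: "real^'n::finite \<Rightarrow> 'b::real_normed_vector"
  assumes "open S" and "\<And>y. y \<in> S \<Longrightarrow> f y = g y"
  shows "Ck_on k S f \<longleftrightarrow> Ck_on k S g"
  using assms(2)
proof (induction k arbitrary: f g)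
  case 0
  then show ?case using continuous_on_cong by force
next
  case (Suc k)
  have "Ck_on k S (partial_deriv i f) \<longleftrightarrow> Ck_on k S (partial_deriv i g)" for i
    by (rule Suc.IH) (simp add: frechet_derivative_cong_open[OF assms(1) _ Suc.prems])
  moreover have "f differentiable (at x) \<longleftrightarrow> g differentiable (at x)" if "x \<in> S" for x
    using differentiable_cong_open[OF assms(1) that Suc.prems] .
  ultimately show ?case by auto
qed

lemma Ck_on_subset: "Ck_on k S f \<Longrightarrow> S' \<subseteq> S \<Longrightarrow> Ck_on k S' f"
  by (induction k arbitrary: f) (auto intro: continuous_on_subset)

text \<open>At order zero the definition asks only for differentiability and for continuity of the partial
  derivatives, so continuity of the function comes from differentiability.\<close>

lemma Ck_on_SucD: "Ck_on (Suc k) S f \<Longrightarrow> Ck_on k S f"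
proof (induction k arbitrary: f)
  case 0
  then have "f differentiable (at x within S)" if "x \<in> S" for x
    using that by (auto intro: differentiable_at_withinI)
  then show ?case
    by (simp add: continuous_on_eq_continuous_within differentiable_imp_continuous_within)
next
  case (Suc k)
  then show ?case by (metis Ck_on.simps(2))
qed

lemma Ck_on_const: "Ck_on k S (\<lambda>x. c)"
  by (induction k arbitrary: c) simp_all

lemma Ck_on_add:
  assumes "open S" and "Ck_on k S f" and "Ck_on k S g"
  shows "Ck_on k S (\<lambda>x. f x + g x)"
  using assms(2,3)
proof (induction k arbitrary: f g)
  case 0
  then show ?case by (auto intro: continuous_on_add)
next
  case (Suc k)
  have d: "f differentiable (at x)" "g differentiable (at x)" if "x \<in> S" for x
    using Suc.prems that by auto
  have D: "frechet_derivative (\<lambda>x. f x + g x) (at x) v =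
      frechet_derivative f (at x) v + frechet_derivative g (at x) v" if "x \<in> S" for x v
    by (rule fun_cong[OF frechet_derivative_at[symmetric]])
      (use d[OF that] has_derivative_add[of f _ "at x" g] frechet_derivative_works in blast)
  have "Ck_on k S (\<lambda>x. partial_deriv i f x + partial_deriv i g x)" for i
    using Suc by simp
  then have "Ck_on k S (partial_deriv i (\<lambda>x. f x + g x))" for i
    by (subst Ck_on_cong[OF assms(1), where g = "\<lambda>x. partial_deriv i f x + partial_deriv i g x"])
      (simp_all add: D)
  then show ?case using d by auto
qed

lemma Ck_on_mult:
  fixes f g :: "real^'n::finite \<Rightarrow> real"
  assumes "open S" and "Ck_on k S f" and "Ck_on k S g"
  shows "Ck_on k S (\<lambda>x. f x * g x)"
  using assms(2,3)
proof (induction k arbitrary: f g)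
  case 0
  then show ?case by (auto intro: continuous_on_mult)
next
  case (Suc k)
  have d: "f differentiable (at x)" "g differentiable (at x)" if "x \<in> S" for x
    using Suc.prems that by auto
  have D: "frechet_derivative (\<lambda>x. f x * g x) (at x) v =
      f x * frechet_derivative g (at x) v + frechet_derivative f (at x) v * g x" if "x \<in> S" for x v
    by (rule fun_cong[OF frechet_derivative_at[symmetric]])
      (use d[OF that] has_derivative_mult[of f _ x UNIV g] frechet_derivative_works in blast)
  have "Ck_on k S (\<lambda>x. f x * partial_deriv i g x + partial_deriv i f x * g x)" for i
    using Suc Ck_on_SucD[OF Suc.prems(1)] Ck_on_SucD[OF Suc.prems(2)] by (auto intro!: Ck_on_add assms(1))
  then have "Ck_on k S (partial_deriv i (\<lambda>x. f x * g x))" for i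
    by (subst Ck_on_cong[OF assms(1), where g = "\<lambda>x. f x * partial_deriv i g x + partial_deriv i f x * g x"])
      (simp_all add: D)
  then show ?case using d by auto
qed

lemma Ck_on_sum:
  assumes "open S" and "\<And>i. i \<in> I \<Longrightarrow> Ck_on k S (f i)"
  shows "Ck_on k S (\<lambda>x. \<Sum>i\<in>I. f i x)"
  using assms(2)
  by (induction I rule: infinite_finite_induct) (simp_all add: Ck_on_const Ck_on_add[OF assms(1)])

lemma Ck_on_bounded_linear:
  assumes "open S" and "bounded_linear h" and "Ck_on k S f"
  shows "Ck_on k S (\<lambda>x. h (f x))"
  using assms(3)
proof (induction k arbitrary: f)
  case 0
  then show ?case using bounded_linear.continuous_on[OF assms(2)] by auto
next
  case (Suc k)
  have d: "f differentiable (at x)" if "x \<in> S" for x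
    using Suc.prems that by auto
  have D: "((\<lambda>x. h (f x)) has_derivative (\<lambda>v. h (frechet_derivative f (at x) v))) (at x)"
    if "x \<in> S" for x
    using bounded_linear.has_derivative[OF assms(2)] d[OF that] frechet_derivative_works by blast
  have "Ck_on k S (partial_deriv i (\<lambda>x. h (f x)))" for i
    by (subst Ck_on_cong[OF assms(1), where g = "\<lambda>x. h (partial_deriv i f x)"])
      (use Suc in \<open>auto simp: fun_cong[OF frechet_derivative_at[OF D, symmetric]]\<close>)
  then show ?case using D by (auto simp: differentiable_def)
qed

lemma linear_axis_expansion:
  fixes D :: "real^'n::finite \<Rightarrow> real"
  assumes "linear D"
  shows "D \<xi> = (\<Sum>l\<in>UNIV. \<xi> $ l * D (axis l 1))"
proof -
  have "D \<xi> = D (\<Sum>l\<in>UNIV. \<xi> $ l *\<^sub>R axis l 1)"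
    by (simp add: basis_expansion[of \<xi>, unfolded scalar_mult_eq_scaleR])
  also have "\<dots> = (\<Sum>l\<in>UNIV. \<xi> $ l * D (axis l 1))"
    using assms by (simp add: linear_sum linear_cmul)
  finally show ?thesis .
qed

lemma frechet_derivative_comp:
  assumes "g differentiable (at x)" and "f differentiable (at (g x))"
  shows "frechet_derivative (f \<circ> g) (at x) v =
    frechet_derivative f (at (g x)) (frechet_derivative g (at x) v)"
  using frechet_derivative_compose[OF assms] by simp

text \<open>By the chain rule a partial derivative of \<open>f \<circ> g\<close> is a sum of products of partial
  derivatives of \<open>g\<close> and partial derivatives of \<open>f\<close> composed with \<open>g\<close>, which are one order less
  smooth; this is what the induction on the order consumes.\<close>

lemma Ck_on_compose:
  fixes f :: "real^'n::finite \<Rightarrow> real" and g :: "real^'m::finite \<Rightarrow> real^'n"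
  assumes "open S" and "g ` S \<subseteq> S'" and "Ck_on k S' f" and "Ck_on k S g"
  shows "Ck_on k S (f \<circ> g)"
  using assms(3,4)
proof (induction k arbitrary: f)
  case 0
  then show ?case
    using continuous_on_compose[of S g f] continuous_on_subset[OF _ assms(2)] by auto
next
  case (Suc k)
  have d: "g differentiable (at x)" "f differentiable (at (g x))" if "x \<in> S" for x
    using Suc.prems that assms(2) by auto
  have lin: "linear (frechet_derivative f (at (g x)))" if "x \<in> S" for x
    using d(2)[OF that] by (rule linear_frechet_derivative)
  have D: "partial_deriv i (f \<circ> g) x = (\<Sum>l\<in>UNIV. partial_deriv i g x $ l * (partial_deriv l f \<circ> g) x)"
    if "x \<in> S" for i x
    unfolding frechet_derivative_comp[OF d[OF that]] comp_apply
    by (rule linear_axis_expansion[OF lin[OF that]])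
  have "Ck_on k S (\<lambda>x. partial_deriv i g x $ l * (partial_deriv l f \<circ> g) x)" for i l
    using Suc Ck_on_SucD[OF Suc.prems(2)]
    by (intro Ck_on_mult Ck_on_bounded_linear[OF _ bounded_linear_vec_nth] assms(1)) auto
  then have "Ck_on k S (partial_deriv i (f \<circ> g))" for i
    by (subst Ck_on_cong[OF assms(1) D]) (auto intro: Ck_on_sum[OF assms(1)])
  moreover have "(f \<circ> g) differentiable (at x)" if "x \<in> S" for x
    using differentiable_chain_at[OF d[OF that]] .
  ultimately show ?case unfolding Ck_on.simps by blast
qed

lemma Cinf_on_compose:
  fixes f :: "real^'n::finite \<Rightarrow> real" and g :: "real^'m::finite \<Rightarrow> real^'n"
  assumes "open S" and "g ` S \<subseteq> S'" and "Cinf_on S' f" and "Cinf_on S g"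
  shows "Cinf_on S (f \<circ> g)"
  using assms Ck_on_compose unfolding Cinf_on_def by blast

lemma Cinf_on_cong:
  fixes f g :: "real^'n::finite \<Rightarrow> 'b::real_normed_vector"
  assumes "open S" and "\<And>y. y \<in> S \<Longrightarrow> f y = g y"
  shows "Cinf_on S f \<longleftrightarrow> Cinf_on S g"
  using Ck_on_cong[OF assms] by (simp add: Cinf_on_def)

lemma Cinf_on_subset: "Cinf_on S f \<Longrightarrow> S' \<subseteq> S \<Longrightarrow> Cinf_on S' f"
  using Ck_on_subset unfolding Cinf_on_def by blast

lemma Cinf_on_partial_deriv: "Cinf_on S f \<Longrightarrow> Cinf_on S (partial_deriv i f)"
  unfolding Cinf_on_def by (metis Ck_on.simps(2))

lemma Cinf_on_differentiable: "Cinf_on S f \<Longrightarrow> x \<in> S \<Longrightarrow> f differentiable (at x)"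
  unfolding Cinf_on_def by (metis Ck_on.simps(2))

section \<open>Smooth functions and vector fields on a manifold\<close>

abbreviation coord_inv :: "('a, 'n::finite) chart \<Rightarrow> real^'n \<Rightarrow> 'a" where
  "coord_inv c \<equiv> inv_into (fst c) (snd c)"

locale smooth_atlas =
  fixes T :: "'a topology" and A :: "('a, 'n::finite) chart set"
  assumes manifold: "smooth_manifold T A"
begin

lemma smooth_functions_iff:
  "f \<in> smooth_functions T A U \<longleftrightarrow>
    openin T U \<and> (\<forall>c\<in>A. Cinf_on (snd c ` (U \<inter> fst c)) (f \<circ> coord_inv c))"
  by (force simp: smooth_functions_def)

lemma tangent_vector_apply:
  "tangent_vector T A c p \<xi> f =
    (if smooth_near T A f p then frechet_derivative (f \<circ> coord_inv c) (at (snd c p)) \<xi> else 0)"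
  by (simp add: tangent_vector_def case_prod_beta)

lemma is_chart_of_atlas:
  assumes "c \<in> A"
  shows "openin T (fst c)" and "open (snd c ` fst c)"
    and "homeomorphic_map (subtopology T (fst c)) (top_of_set (snd c ` fst c)) (snd c)"
  using manifold assms by (auto simp: smooth_manifold_def is_chart_def case_prod_beta)

lemma ex_chart: "p \<in> topspace T \<Longrightarrow> \<exists>c\<in>A. p \<in> fst c"
  using manifold unfolding smooth_manifold_def by blast

lemma inj_on_chart:
  assumes "c \<in> A"
  shows "inj_on (snd c) (fst c)"
  using homeomorphic_imp_injective_map[OF is_chart_of_atlas(3)[OF assms]]
  unfolding topspace_subtopology_subset[OF openin_subset[OF is_chart_of_atlas(1)[OF assms]]] .

lemma coord_inv_chart [simp]: "c \<in> A \<Longrightarrow> p \<in> fst c \<Longrightarrow> coord_inv c (snd c p) = p"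
  by (simp add: inj_on_chart)

lemma open_chart_image:
  assumes "c \<in> A" and "openin T U"
  shows "open (snd c ` (U \<inter> fst c))"
proof -
  have "openin (subtopology T (fst c)) (U \<inter> fst c)"
    using assms(2) by (auto simp: openin_subtopology)
  then have "openin (top_of_set (snd c ` fst c)) (snd c ` (U \<inter> fst c))"
    using homeomorphic_imp_open_map[OF is_chart_of_atlas(3)[OF assms(1)]]
    unfolding open_map_def by blast
  then show ?thesis
    using is_chart_of_atlas(2)[OF assms(1)] openin_open_trans by blast
qed

lemma Cinf_on_transition:
  assumes "c \<in> A" and "d \<in> A"
  shows "Cinf_on (snd c ` (fst c \<inter> fst d)) (snd d \<circ> coord_inv c)"
  using manifold assms
  by (force simp: smooth_manifold_def smooth_transition_def case_prod_beta)

lemma smooth_functions_openin: "f \<in> smooth_functions T A U \<Longrightarrow> openin T U"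
  by (simp add: smooth_functions_iff)

lemma smooth_functions_subset:
  assumes "f \<in> smooth_functions T A U" and "openin T V" and "V \<subseteq> U"
  shows "f \<in> smooth_functions T A V"
  unfolding smooth_functions_iff
proof (intro conjI ballI)
  fix c assume c: "c \<in> A"
  have "snd c ` (V \<inter> fst c) \<subseteq> snd c ` (U \<inter> fst c)"
    using assms(3) by blast
  then show "Cinf_on (snd c ` (V \<inter> fst c)) (f \<circ> coord_inv c)"
    using assms(1) c Cinf_on_subset unfolding smooth_functions_iff by blast
qed (rule assms(2))

lemma smooth_functions_cong:
  assumes "f \<in> smooth_functions T A U" and "\<And>p. p \<in> U \<Longrightarrow> f p = g p"
  shows "g \<in> smooth_functions T A U"
  unfolding smooth_functions_iff
proof (intro conjI ballI)
  show U: "openin T U"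
    using assms(1) by (rule smooth_functions_openin)
  fix c assume c: "c \<in> A"
  have "(f \<circ> coord_inv c) y = (g \<circ> coord_inv c) y" if "y \<in> snd c ` (U \<inter> fst c)" for y
    using that assms(2) c by auto
  then show "Cinf_on (snd c ` (U \<inter> fst c)) (g \<circ> coord_inv c)"
    using assms(1) c Cinf_on_cong[OF open_chart_image[OF c U]] unfolding smooth_functions_iff
    by blast
qed

lemma smooth_functions_const: "openin T U \<Longrightarrow> (\<lambda>p. r) \<in> smooth_functions T A U"
  by (simp add: smooth_functions_iff Cinf_on_def comp_def Ck_on_const)

lemma smooth_functions_add:
  "f \<in> smooth_functions T A U \<Longrightarrow> g \<in> smooth_functions T A U \<Longrightarrow>
    (\<lambda>p. f p + g p) \<in> smooth_functions T A U"
  by (auto simp: smooth_functions_iff Cinf_on_def comp_def intro!: Ck_on_add open_chart_image)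

lemma smooth_functions_mult:
  "f \<in> smooth_functions T A U \<Longrightarrow> g \<in> smooth_functions T A U \<Longrightarrow>
    (\<lambda>p. f p * g p) \<in> smooth_functions T A U"
  by (auto simp: smooth_functions_iff Cinf_on_def comp_def intro!: Ck_on_mult open_chart_image)

lemma smooth_functions_coordinate:
  assumes "c \<in> A"
  shows "(\<lambda>q. snd c q $ i) \<in> smooth_functions T A (fst c)"
  unfolding smooth_functions_iff
proof (intro conjI ballI)
  fix d assume d: "d \<in> A"
  have "Cinf_on (snd d ` (fst c \<inter> fst d)) (snd c \<circ> coord_inv d)"
    using Cinf_on_transition[OF d assms] by (simp add: Int_commute)
  then have "Cinf_on (snd d ` (fst c \<inter> fst d)) (\<lambda>y. (snd c \<circ> coord_inv d) y $ i)"
    unfolding Cinf_on_def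
    by (intro allI Ck_on_bounded_linear[OF open_chart_image[OF d is_chart_of_atlas(1)[OF assms]]
        bounded_linear_vec_nth]) (erule spec)
  then show "Cinf_on (snd d ` (fst c \<inter> fst d)) ((\<lambda>q. snd c q $ i) \<circ> coord_inv d)"
    by (simp only: comp_def)
qed (rule is_chart_of_atlas(1)[OF assms])

lemma smooth_near_coordinate: "c \<in> A \<Longrightarrow> p \<in> fst c \<Longrightarrow> smooth_near T A (\<lambda>q. snd c q $ i) p"
  using smooth_functions_coordinate unfolding smooth_near_def by blast

lemma differentiable_in_chart:
  assumes "c \<in> A" and "p \<in> fst c" and "smooth_near T A f p"
  shows "(f \<circ> coord_inv c) differentiable (at (snd c p))"
proof -
  obtain W where "p \<in> W" and "Cinf_on (snd c ` (W \<inter> fst c)) (f \<circ> coord_inv c)"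
    using assms(1,3) unfolding smooth_near_def smooth_functions_iff by blast
  then show ?thesis
    using assms(2) by (intro Cinf_on_differentiable) auto
qed

lemma tangent_vector_expansion:
  assumes "c \<in> A" and "p \<in> fst c"
  shows "tangent_vector T A c p \<xi> f = (\<Sum>i\<in>UNIV. \<xi> $ i * tangent_vector T A c p (axis i 1) f)"
proof (cases "smooth_near T A f p")
  case True
  have "linear (frechet_derivative (f \<circ> coord_inv c) (at (snd c p)))"
    by (intro linear_frechet_derivative differentiable_in_chart assms True)
  from linear_axis_expansion[OF this, of \<xi>] True show ?thesis
    by (simp add: tangent_vector_apply)
qed (simp add: tangent_vector_apply)

text \<open>Read in the chart \<open>c\<close>, the coordinate function is the linear functional \<open>y \<mapsto> y $ i\<close>, which is
  its own derivative.\<close>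

lemma tangent_vector_coordinate:
  assumes "c \<in> A" and "p \<in> fst c"
  shows "tangent_vector T A c p \<xi> (\<lambda>q. snd c q $ i) = \<xi> $ i"
proof -
  have "frechet_derivative ((\<lambda>q. snd c q $ i) \<circ> coord_inv c) (at (snd c p))
      = frechet_derivative (\<lambda>y. y $ i) (at (snd c p))"
    by (rule frechet_derivative_cong_open[OF is_chart_of_atlas(2)[OF assms(1)]])
      (use assms in auto)
  also have "\<dots> = (\<lambda>y. y $ i)"
    by (rule frechet_derivative_at[symmetric])
      (rule bounded_linear_imp_has_derivative[OF bounded_linear_vec_nth])
  finally show ?thesis
    using smooth_near_coordinate[OF assms] by (simp add: tangent_vector_apply)
qed

text \<open>Near \<open>p\<close> the two coordinate expressions of \<open>f\<close> differ by the transition map, so this is the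
  chain rule. It allows every tangent vector at \<open>p\<close> to be written in one chosen chart.\<close>

lemma tangent_vector_change_chart:
  assumes "c \<in> A" "d \<in> A" and "p \<in> fst c" "p \<in> fst d"
  shows "tangent_vector T A d p \<xi> =
    tangent_vector T A c p (frechet_derivative (snd c \<circ> coord_inv d) (at (snd d p)) \<xi>)"
proof
  fix f
  show "tangent_vector T A d p \<xi> f =
    tangent_vector T A c p (frechet_derivative (snd c \<circ> coord_inv d) (at (snd d p)) \<xi>) f"
  proof (cases "smooth_near T A f p")
    case True
    let ?g = "snd c \<circ> coord_inv d"
    have S: "open (snd d ` (fst c \<inter> fst d))"
      by (intro open_chart_image is_chart_of_atlas assms)
    have p: "snd d p \<in> snd d ` (fst c \<inter> fst d)" and gp: "?g (snd d p) = snd c p"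
      using assms by auto
    have g: "?g differentiable (at (snd d p))"
      using Cinf_on_transition[OF assms(2,1)] p by (auto simp: Int_commute intro: Cinf_on_differentiable)
    have f: "(f \<circ> coord_inv c) differentiable (at (?g (snd d p)))"
      unfolding gp by (intro differentiable_in_chart assms True)
    have D: "frechet_derivative (f \<circ> coord_inv d) (at (snd d p))
        = frechet_derivative ((f \<circ> coord_inv c) \<circ> ?g) (at (snd d p))"
      by (rule frechet_derivative_cong_open[OF S p]) (use assms in auto)
    have "frechet_derivative (f \<circ> coord_inv d) (at (snd d p)) \<xi>
        = frechet_derivative (f \<circ> coord_inv c) (at (snd c p)) (frechet_derivative ?g (at (snd d p)) \<xi>)"
      unfolding D by (rule frechet_derivative_comp[OF g f, unfolded gp])
    then show ?thesis
      using True by (simp add: tangent_vector_apply)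
  qed (simp add: tangent_vector_apply)
qed

lemma tangent_space_chart:
  assumes "c \<in> A" and "p \<in> fst c"
  shows "tangent_space T A p = range (tangent_vector T A c p)"
proof
  show "range (tangent_vector T A c p) \<subseteq> tangent_space T A p"
    using assms unfolding tangent_space_def by blast
  show "tangent_space T A p \<subseteq> range (tangent_vector T A c p)"
    using tangent_vector_change_chart[OF assms(1) _ assms(2)] unfolding tangent_space_def by fastforce
qed

lemma tangent_space_combination:
  assumes "v \<in> tangent_space T A p" and "w \<in> tangent_space T A p"
  shows "(\<lambda>f. r * v f + s * w f) \<in> tangent_space T A p"
proof -
  obtain c where c: "c \<in> A" "p \<in> fst c"
    using assms(1) unfolding tangent_space_def by blast
  obtain \<xi> \<eta> where "v = tangent_vector T A c p \<xi>" "w = tangent_vector T A c p \<eta>"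
    using assms tangent_space_chart[OF c] by auto
  then have "(\<lambda>f. r * v f + s * w f) = tangent_vector T A c p (r *\<^sub>R \<xi> + s *\<^sub>R \<eta>)"
    by (auto simp: fun_eq_iff tangent_vector_expansion[OF c, of \<xi>] tangent_vector_expansion[OF c, of \<eta>]
        tangent_vector_expansion[OF c, of "r *\<^sub>R \<xi> + s *\<^sub>R \<eta>"]
        sum_distrib_left sum.distrib algebra_simps)
  then show ?thesis
    using tangent_space_chart[OF c] by auto
qed

lemma vfields_zero_outside: "X \<in> vfields T A U \<Longrightarrow> p \<notin> U \<Longrightarrow> X p = 0"
  by (simp add: vfields_def)

lemma vfields_smooth:
  "X \<in> vfields T A U \<Longrightarrow> W \<subseteq> U \<Longrightarrow> f \<in> smooth_functions T A W \<Longrightarrow> (\<lambda>p. X p f) \<in> smooth_functions T A W"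
  unfolding vfields_def by blast

lemma vapply_smooth:
  "X \<in> vfields T A U \<Longrightarrow> f \<in> smooth_functions T A U \<Longrightarrow> vapply X f \<in> smooth_functions T A U"
  unfolding vapply_def by (rule vfields_smooth) auto

lemma vfields_combination:
  assumes X: "X \<in> vfields T A U" and Y: "Y \<in> vfields T A U"
    and f: "f \<in> smooth_functions T A U" and g: "g \<in> smooth_functions T A U"
  shows "f \<cdot>\<^sub>v X + g \<cdot>\<^sub>v Y \<in> vfields T A U"
  unfolding vfields_def
proof (intro CollectI conjI ballI allI impI)
  fix p assume p: "p \<in> U"
  have "(f \<cdot>\<^sub>v X + g \<cdot>\<^sub>v Y) p = (\<lambda>h. f p * X p h + g p * Y p h)"
    by (simp add: fscale_def fun_eq_iff)
  then show "(f \<cdot>\<^sub>v X + g \<cdot>\<^sub>v Y) p \<in> tangent_space T A p"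
    using X Y p tangent_space_combination[of "X p" p "Y p" "f p" "g p"] by (simp add: vfields_def)
next
  fix p assume "p \<notin> U"
  then show "(f \<cdot>\<^sub>v X + g \<cdot>\<^sub>v Y) p = 0"
    using vfields_zero_outside[OF X] vfields_zero_outside[OF Y] by (simp add: fscale_def fun_eq_iff)
next
  fix W h assume W: "W \<subseteq> U" and h: "h \<in> smooth_functions T A W"
  have "(\<lambda>p. f p * X p h + g p * Y p h) \<in> smooth_functions T A W"
    using W h X Y f g smooth_functions_openin[OF h]
    by (intro smooth_functions_add smooth_functions_mult) (auto intro: smooth_functions_subset vfields_smooth)
  then show "(\<lambda>p. (f \<cdot>\<^sub>v X + g \<cdot>\<^sub>v Y) p h) \<in> smooth_functions T A W"
    by (simp add: fscale_def)
qed

lemma vfields_add: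
  assumes "openin T U" "X \<in> vfields T A U" "Y \<in> vfields T A U"
  shows "X + Y \<in> vfields T A U"
  using vfields_combination[OF assms(2,3) smooth_functions_const[OF assms(1), of 1]
      smooth_functions_const[OF assms(1), of 1]]
  by (simp add: fscale_def)

lemma vfields_diff:
  assumes "openin T U" "X \<in> vfields T A U" "Y \<in> vfields T A U"
  shows "X - Y \<in> vfields T A U"
proof -
  have "X - Y = (\<lambda>p. 1) \<cdot>\<^sub>v X + (\<lambda>p. -1) \<cdot>\<^sub>v Y"
    by (simp add: fscale_def fun_eq_iff)
  then show ?thesis
    using vfields_combination[OF assms(2,3) smooth_functions_const[OF assms(1), of 1]
      smooth_functions_const[OF assms(1), of "-1"]] by simp
qed

lemma vfields_fscale:
  assumes "X \<in> vfields T A U" "f \<in> smooth_functions T A U"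
  shows "f \<cdot>\<^sub>v X \<in> vfields T A U"
proof -
  have "f \<cdot>\<^sub>v X = f \<cdot>\<^sub>v X + (\<lambda>p. 0) \<cdot>\<^sub>v X"
    by (simp add: fscale_def fun_eq_iff)
  then show ?thesis
    using vfields_combination[OF assms(1,1,2) smooth_functions_const[of U 0]]
      smooth_functions_openin[OF assms(2)] by simp
qed

text \<open>The null vector is a tangent vector because every point lies in the domain of a chart.\<close>

lemma vfields_zero:
  assumes "openin T U"
  shows "0 \<in> vfields T A U"
  unfolding vfields_def
proof (intro CollectI conjI ballI allI impI)
  fix p assume "p \<in> U"
  then obtain c where c: "c \<in> A" "p \<in> fst c"
    using ex_chart openin_subset[OF assms] by blast
  have "tangent_vector T A c p 0 = 0"
    using tangent_vector_expansion[OF c, of 0] by (simp add: fun_eq_iff)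
  then show "(0 :: 'a vfield) p \<in> tangent_space T A p"
    using tangent_space_chart[OF c] by (metis rangeI zero_fun_apply)
next
  fix W f assume "f \<in> smooth_functions T A W"
  then show "(\<lambda>p. (0 :: 'a vfield) p f) \<in> smooth_functions T A W"
    using smooth_functions_openin smooth_functions_const by simp
qed simp

lemma vfields_sum:
  assumes "openin T U" and "\<And>i. i \<in> I \<Longrightarrow> X i \<in> vfields T A U"
  shows "(\<Sum>i\<in>I. X i) \<in> vfields T A U"
  using assms(2)
  by (induction I rule: infinite_finite_induct) (simp_all add: vfields_add vfields_zero assms(1))

lemma vfields_vrestrict:
  assumes "X \<in> vfields T A U" and "V \<subseteq> U"
  shows "X \<restriction> V \<in> vfields T A V"
  unfolding vfields_def
proof (intro CollectI conjI ballI allI impI)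
  fix W f assume W: "W \<subseteq> V" and f: "f \<in> smooth_functions T A W"
  show "(\<lambda>p. (X \<restriction> V) p f) \<in> smooth_functions T A W"
    by (rule smooth_functions_cong[OF vfields_smooth[OF assms(1) _ f]])
      (use W assms(2) in \<open>auto simp: vrestrict_def\<close>)
qed (use assms in \<open>auto simp: vrestrict_def vfields_def\<close>)

lemma vfields_eqI:
  assumes "X \<in> vfields T A U" "Y \<in> vfields T A U" and "\<And>p. p \<in> U \<Longrightarrow> X p = Y p"
  shows "X = Y"
  using assms vfields_zero_outside by (metis ext)

lemma vrestrict_apply: "p \<in> V \<Longrightarrow> (X \<restriction> V) p = X p"
  by (simp add: vrestrict_def)

lemma vrestrict_self: "X \<in> vfields T A U \<Longrightarrow> X \<restriction> U = X"
  using vfields_zero_outside by (auto simp: vrestrict_def fun_eq_iff)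

lemma vrestrict_vrestrict: "V \<subseteq> U \<Longrightarrow> X \<restriction> U \<restriction> V = X \<restriction> V"
  by (auto simp: vrestrict_def fun_eq_iff)

section \<open>Coordinate vector fields\<close>

text \<open>In another chart \<open>d\<close>, the function \<open>\<partial>\<^sub>j f\<close> reads as the partial derivative of the coordinate
  expression of \<open>f\<close> in \<open>c\<close>, composed with the transition map from \<open>d\<close> to \<open>c\<close>.\<close>

lemma coord_vfield_in_vfields:
  assumes c: "c \<in> A"
  shows "coord_vfield T A c j \<in> vfields T A (fst c)"
  unfolding vfields_def
proof (intro CollectI conjI ballI allI impI)
  fix p assume "p \<in> fst c"
  then show "coord_vfield T A c j p \<in> tangent_space T A p"
    using tangent_space_chart[OF c] by (simp add: coord_vfield_def)
next
  fix p assume "p \<notin> fst c"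
  then show "coord_vfield T A c j p = 0"
    by (simp add: coord_vfield_def)
next
  fix W f assume W: "W \<subseteq> fst c" and f: "f \<in> smooth_functions T A W"
  have oW: "openin T W"
    using f by (rule smooth_functions_openin)
  show "(\<lambda>p. coord_vfield T A c j p f) \<in> smooth_functions T A W"
    unfolding smooth_functions_iff
  proof (intro conjI ballI oW)
    fix d assume d: "d \<in> A"
    let ?S = "snd d ` (W \<inter> fst d)"
    have "Cinf_on ?S (partial_deriv j (f \<circ> coord_inv c) \<circ> (snd c \<circ> coord_inv d))"
    proof (rule Cinf_on_compose[OF open_chart_image[OF d oW]])
      show "(snd c \<circ> coord_inv d) ` ?S \<subseteq> snd c ` (W \<inter> fst c)"
        using W d by auto
      show "Cinf_on (snd c ` (W \<inter> fst c)) (partial_deriv j (f \<circ> coord_inv c))"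
        using f c by (intro Cinf_on_partial_deriv) (simp add: smooth_functions_iff)
      show "Cinf_on ?S (snd c \<circ> coord_inv d)"
        by (rule Cinf_on_subset[OF Cinf_on_transition[OF d c]]) (use W in auto)
    qed
    moreover have "(partial_deriv j (f \<circ> coord_inv c) \<circ> (snd c \<circ> coord_inv d)) y
        = ((\<lambda>p. coord_vfield T A c j p f) \<circ> coord_inv d) y" if y: "y \<in> ?S" for y
    proof -
      obtain p where p: "p \<in> W" "p \<in> fst d" "y = snd d p"
        using y by auto
      have "smooth_near T A f p"
        using p f unfolding smooth_near_def by blast
      then show ?thesis
        using p W d by (auto simp: coord_vfield_def tangent_vector_apply)
    qed
    ultimately show "Cinf_on ?S ((\<lambda>p. coord_vfield T A c j p f) \<circ> coord_inv d)"
      using Cinf_on_cong[OF open_chart_image[OF d oW]] by blast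
  qed
qed

lemma component_smooth:
  assumes "c \<in> A" and "X \<in> vfields T A U" and "openin T U" and "U \<subseteq> fst c"
  shows "component c X i \<in> smooth_functions T A U"
  unfolding component_def
  using vapply_smooth[OF assms(2)] smooth_functions_subset[OF smooth_functions_coordinate[OF assms(1)] assms(3,4)]
  by blast

text \<open>A tangent vector at \<open>p\<close> is a combination of the coordinate vectors, and its values on the
  coordinate functions recover the coefficients.\<close>

lemma vfield_expansion:
  assumes "c \<in> A" and "X \<in> vfields T A U" and "U \<subseteq> fst c"
  shows "X = (\<Sum>i\<in>UNIV. component c X i \<cdot>\<^sub>v (coord_vfield T A c i \<restriction> U))"
proof (intro ext)
  fix p f
  have sum_apply: "(\<Sum>i\<in>I. F i) p f = (\<Sum>i\<in>I. F i p f)" for I and F :: "'n \<Rightarrow> 'a vfield"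
    by (induction I rule: infinite_finite_induct) simp_all
  show "X p f = (\<Sum>i\<in>UNIV. component c X i \<cdot>\<^sub>v (coord_vfield T A c i \<restriction> U)) p f"
  proof (cases "p \<in> U")
    case True
    then have p: "p \<in> fst c"
      using assms(3) by blast
    have "X p \<in> range (tangent_vector T A c p)"
      using assms(2) True unfolding tangent_space_chart[OF assms(1) p, symmetric] vfields_def by simp
    then obtain \<xi> where \<xi>: "X p = tangent_vector T A c p \<xi>"
      by blast
    have "component c X i p = \<xi> $ i" for i
      using tangent_vector_coordinate[OF assms(1) p] by (simp add: component_def vapply_def \<xi>)
    then show ?thesis
      using True p tangent_vector_expansion[OF assms(1) p, of \<xi> f]
      by (simp add: sum_apply fscale_def vrestrict_def coord_vfield_def \<xi>)
  next
    case False
    then show ?thesis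
      using vfields_zero_outside[OF assms(2)] by (simp add: sum_apply fscale_def vrestrict_def)
  qed
qed

end

section \<open>Twisting a compatible connection, algebraically\<close>

text \<open>To be read with \<open>M\<close> the vector fields on one open set, \<open>m\<close> the product, \<open>D\<close> the
  connection and \<open>br\<close> the Lie bracket. For a torsionless connection the bracket is the commutator
  of \<open>D\<close>, which is why \<open>M\<close> is closed under it.\<close>

locale compatible_connection_algebra =
  fixes M :: "'v::ab_group_add set" and m D br :: "'v \<Rightarrow> 'v \<Rightarrow> 'v"
  assumes add_closed: "x \<in> M \<Longrightarrow> y \<in> M \<Longrightarrow> x + y \<in> M"
    and diff_closed: "x \<in> M \<Longrightarrow> y \<in> M \<Longrightarrow> x - y \<in> M"
    and m_closed: "x \<in> M \<Longrightarrow> y \<in> M \<Longrightarrow> m x y \<in> M"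
    and D_closed: "x \<in> M \<Longrightarrow> y \<in> M \<Longrightarrow> D x y \<in> M"
    and m_comm: "x \<in> M \<Longrightarrow> y \<in> M \<Longrightarrow> m x y = m y x"
    and m_assoc: "x \<in> M \<Longrightarrow> y \<in> M \<Longrightarrow> z \<in> M \<Longrightarrow> m (m x y) z = m x (m y z)"
    and m_add_right: "x \<in> M \<Longrightarrow> y \<in> M \<Longrightarrow> z \<in> M \<Longrightarrow> m x (y + z) = m x y + m x z"
    and torsion: "x \<in> M \<Longrightarrow> y \<in> M \<Longrightarrow> D x y - D y x = br x y"
    and compat: "x \<in> M \<Longrightarrow> y \<in> M \<Longrightarrow> z \<in> M \<Longrightarrow>
      D x (m y z) - m (D x y) z - m y (D x z) = D y (m x z) - m (D y x) z - m x (D y z)"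
begin

lemma m_diff_right:
  assumes "x \<in> M" "y \<in> M" "z \<in> M"
  shows "m x (y - z) = m x y - m x z"
  using m_add_right[of x "y - z" z] assms diff_closed by (simp add: algebra_simps)

lemma m_left_comm:
  assumes "x \<in> M" "y \<in> M" "z \<in> M"
  shows "m x (m y z) = m y (m x z)"
  using assms m_assoc[of x y z] m_assoc[of y x z] m_comm[of x y] by simp

lemma br_closed: "x \<in> M \<Longrightarrow> y \<in> M \<Longrightarrow> br x y \<in> M"
  using torsion[of x y] diff_closed D_closed by metis

text \<open>The covariant derivative \<open>(\<nabla>\<^sub>x c)(y, z)\<close> of the product.\<close>

definition dm :: "'v \<Rightarrow> 'v \<Rightarrow> 'v \<Rightarrow> 'v" where
  "dm x y z = D x (m y z) - m (D x y) z - m y (D x z)"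

lemma dm_closed: "x \<in> M \<Longrightarrow> y \<in> M \<Longrightarrow> z \<in> M \<Longrightarrow> dm x y z \<in> M"
  by (simp add: dm_def diff_closed m_closed D_closed)

lemma dm_swap12: "x \<in> M \<Longrightarrow> y \<in> M \<Longrightarrow> z \<in> M \<Longrightarrow> dm x y z = dm y x z"
  unfolding dm_def by (rule compat)

lemma dm_swap23: "x \<in> M \<Longrightarrow> y \<in> M \<Longrightarrow> z \<in> M \<Longrightarrow> dm x y z = dm x z y"
  by (simp add: dm_def m_comm D_closed algebra_simps)

lemma D_m:
  "D x (m y z) = dm x y z + m (D x y) z + m y (D x z)"
  by (simp add: dm_def)

text \<open>This is the associative law \<open>(x y) z = x (y z)\<close> differentiated in the direction \<open>w\<close>: the terms
  in which the derivative falls on \<open>x\<close>, \<open>y\<close> or \<open>z\<close> cancel.\<close>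

lemma dm_assoc:
  assumes "w \<in> M" "x \<in> M" "y \<in> M" "z \<in> M"
  shows "dm w (m x y) z + m z (dm w x y) = dm w x (m y z) + m x (dm w y z)"
  using assms
  by (simp add: dm_def m_diff_right m_add_right m_closed D_closed diff_closed add_closed
      m_assoc m_comm m_left_comm algebra_simps)

end

locale twisting_algebra = compatible_connection_algebra M m D br
  for M :: "'v::ab_group_add set" and m D br +
  fixes p q :: 'v
  assumes p: "p \<in> M" and q: "q \<in> M"
    and unit: "y \<in> M \<Longrightarrow> m (m p q) y = y"
    and sym_D_p: "y \<in> M \<Longrightarrow> z \<in> M \<Longrightarrow> m y (D z p) = m z (D y p)"
begin

lemma p_q_cancel: "y \<in> M \<Longrightarrow> m p (m q y) = y"
  using unit[of y] m_assoc[of p q y] p q by simp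

lemma q_p_cancel: "y \<in> M \<Longrightarrow> m q (m p y) = y"
  using p_q_cancel[of y] m_left_comm[of p q y] p q by simp

definition twisted :: "'v \<Rightarrow> 'v \<Rightarrow> 'v" where
  "twisted y z = m q (D y (m p z))"

text \<open>The derivative of \<open>p z\<close> in the direction \<open>y\<close> has three terms. After antisymmetrizing in
  \<open>y\<close> and \<open>z\<close>, the one with the derivative of the product drops out by compatibility, the one with
  the derivative of \<open>p\<close> drops out by the hypothesis on \<open>p\<close>, and the last one becomes \<open>p\<close> times
  \<open>D y z - D z y\<close>.\<close>

lemma twisted_torsion:
  assumes "y \<in> M" "z \<in> M"
  shows "twisted y z - twisted z y = br y z"
proof -
  have dm_sym: "dm y p z = dm z p y"
    using dm_swap12[of y p z] dm_swap23[of p y z] dm_swap12[of p z y] assms p by simp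
  have "D y (m p z) - D z (m p y)
      = (dm y p z - dm z p y) + (m (D y p) z - m (D z p) y) + (m p (D y z) - m p (D z y))"
    by (simp add: D_m)
  also have "m (D y p) z = m (D z p) y"
    using sym_D_p[OF assms] m_comm D_closed assms p by simp
  also have "m p (D y z) - m p (D z y) = m p (br y z)"
    using assms p D_closed by (simp add: torsion[symmetric] m_diff_right)
  finally have "D y (m p z) - D z (m p y) = m p (br y z)"
    using dm_sym by simp
  moreover have "twisted y z - twisted z y = m q (D y (m p z) - D z (m p y))"
    using assms p q by (simp add: twisted_def m_diff_right m_closed D_closed)
  ultimately show ?thesis
    using q_p_cancel br_closed assms by simp
qed

text \<open>The derivatives of \<open>y\<close> and \<open>z\<close> cancel, which leaves the product rule for the factor \<open>p\<close>. The
  last term on the right is symmetric in \<open>x\<close> and \<open>y\<close> by the hypothesis on \<open>p\<close>.\<close>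

lemma twisted_deriv_product:
  assumes "x \<in> M" "y \<in> M" "z \<in> M"
  shows "twisted x (m y z) - m (twisted x y) z - m y (twisted x z)
    = m q (dm x (m p y) z - m y (dm x p z) - m (m y z) (D x p))"
proof -
  have "twisted x (m y z) - m (twisted x y) z - m y (twisted x z)
      = m q (D x (m (m p y) z) - m (D x (m p y)) z - m y (D x (m p z)))"
    using assms p q
    by (simp add: twisted_def m_diff_right m_closed D_closed diff_closed m_assoc m_left_comm[of _ q])
  also have "D x (m (m p y) z) - m (D x (m p y)) z - m y (D x (m p z))
      = dm x (m p y) z - m y (dm x p z) - m (m y z) (D x p)"
    using assms p
    by (simp add: dm_def m_diff_right m_add_right m_closed D_closed diff_closed add_closed m_assoc m_comm m_left_comm
        algebra_simps)
  finally show ?thesis .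
qed

text \<open>By total symmetry of \<open>dm\<close> the direction can be moved to \<open>z\<close>. What remains is the derivative, in
  the direction \<open>z\<close>, of \<open>(p y) x = (p x) y\<close>, that is, two instances of the differentiated associative
  law.\<close>

lemma twisted_compatible:
  assumes "x \<in> M" "y \<in> M" "z \<in> M"
  shows "twisted x (m y z) - m (twisted x y) z - m y (twisted x z)
    = twisted y (m x z) - m (twisted y x) z - m x (twisted y z)"
proof -
  have "dm z (m p y) x + m x (dm z p y) = dm z (m p x) y + m y (dm z p x)"
    using dm_assoc[of z p y x] dm_assoc[of z p x y] dm_swap23[of z x y] m_comm[of x y] assms p
    by (simp add: m_closed dm_closed)
  moreover have "dm z (m p y) x = dm x (m p y) z" "dm z (m p x) y = dm y (m p x) z"
      "dm z p y = dm y p z" "dm z p x = dm x p z"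
    using dm_swap12 dm_swap23 assms p m_closed by metis+
  ultimately have "dm x (m p y) z - m y (dm x p z) = dm y (m p x) z - m x (dm y p z)"
    by (simp add: algebra_simps)
  moreover have "m (m y z) (D x p) = m (m x z) (D y p)"
    using sym_D_p[OF assms(1,2)] m_comm[of x z] m_comm[of y z] assms p
    by (simp add: m_assoc D_closed)
  ultimately show ?thesis
    by (simp add: twisted_deriv_product assms)
qed

lemma twisted_deriv_product_commute:
  assumes "x \<in> M" "y \<in> M" "z \<in> M"
  shows "twisted x (m y z) - m (twisted x y) z - m y (twisted x z)
    = twisted x (m z y) - m (twisted x z) y - m z (twisted x y)"
  using assms p q m_comm[of y z] m_comm[of "twisted x y" z] m_comm[of "twisted x z" y]
  by (simp add: twisted_def m_closed D_closed algebra_simps)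

text \<open>Between two successive twisted derivatives the factors \<open>p\<close> and \<open>q\<close> cancel, so the twisted
  connection is a conjugate of the old one and its curvature is the conjugated curvature.\<close>

lemma twisted_riemann:
  assumes "x \<in> M" "y \<in> M" "z \<in> M"
  shows "twisted x (twisted y z) - twisted y (twisted x z) - twisted (br x y) z
    = m q (D x (D y (m p z)) - D y (D x (m p z)) - D (br x y) (m p z))"
  using assms p q
  by (simp add: twisted_def p_q_cancel m_diff_right m_closed D_closed diff_closed br_closed)

text \<open>Conjugation turns the cyclic condition at \<open>w\<close> into \<open>q\<close> times the original cyclic condition at
  \<open>p w\<close>.\<close>

lemma twisted_curvature:
  assumes curv: "\<And>x y z w. x \<in> M \<Longrightarrow> y \<in> M \<Longrightarrow> z \<in> M \<Longrightarrow> w \<in> M \<Longrightarrow>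
      R y z (m x w) + R x y (m z w) + R z x (m y w) = 0"
    and R: "\<And>x y z. R x y z = D x (D y z) - D y (D x z) - D (br x y) z"
    and R': "\<And>x y z. R' x y z = twisted x (twisted y z) - twisted y (twisted x z) - twisted (br x y) z"
    and M: "x \<in> M" "y \<in> M" "z \<in> M" "w \<in> M"
  shows "R' y z (m x w) + R' x y (m z w) + R' z x (m y w) = 0"
proof -
  have R_closed: "R a b c \<in> M" if "a \<in> M" "b \<in> M" "c \<in> M" for a b c
    using that by (simp add: R D_closed diff_closed br_closed)
  have R'_R: "R' a b (m c w) = m q (R a b (m c (m p w)))" if "a \<in> M" "b \<in> M" "c \<in> M" for a b c
    using that M p twisted_riemann[of a b "m c w"] m_left_comm[of p c w]
    by (simp add: R R' m_closed)
  have "R' y z (m x w) + R' x y (m z w) + R' z x (m y w)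
      = m q (R y z (m x (m p w)) + R x y (m z (m p w)) + R z x (m y (m p w)))"
    using M p q by (simp add: R'_R m_add_right R_closed m_closed add_closed)
  also have "\<dots> = m q 0"
    using M p by (simp add: curv m_closed)
  also have "m q 0 = 0"
    using m_diff_right[OF q p p] by simp
  finally show ?thesis .
qed

end

section \<open>Tensors and coordinate frames\<close>

lemma component_sum: "component c (\<Sum>i\<in>I. X i) j p = (\<Sum>i\<in>I. component c (X i) j p)"
  by (induction I rule: infinite_finite_induct) (simp_all add: component_def vapply_def)

lemma component_fscale: "component c (f \<cdot>\<^sub>v X) j p = f p * component c X j p"
  by (simp add: component_def vapply_def fscale_def)

context smooth_atlas
begin

text \<open>On a chart domain the coordinate fields are a basis of the module of vector fields over the
  smooth functions, so a function-linear map is determined by their images.\<close>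

lemma tensor_expansion:
  fixes F :: "'a vfield \<Rightarrow> 'a vfield"
  assumes c: "c \<in> A" and U: "openin T U" "U \<subseteq> fst c" and Y: "Y \<in> vfields T A U"
    and add: "\<And>X Y. X \<in> vfields T A U \<Longrightarrow> Y \<in> vfields T A U \<Longrightarrow> F (X + Y) = F X + F Y"
    and scale: "\<And>f X. f \<in> smooth_functions T A U \<Longrightarrow> X \<in> vfields T A U \<Longrightarrow> F (f \<cdot>\<^sub>v X) = f \<cdot>\<^sub>v F X"
  shows "F Y = (\<Sum>i\<in>UNIV. component c Y i \<cdot>\<^sub>v F (coord_vfield T A c i \<restriction> U))"
proof -
  have zero: "F 0 = 0"
    using add[of 0 0] vfields_zero[OF U(1)] by simp
  have sum: "F (\<Sum>i\<in>I. X i) = (\<Sum>i\<in>I. F (X i))"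
    if "\<And>i. i \<in> I \<Longrightarrow> X i \<in> vfields T A U" for I and X :: "'n \<Rightarrow> 'a vfield"
    using that
    by (induction I rule: infinite_finite_induct) (simp_all add: zero add vfields_sum U(1))
  have e: "coord_vfield T A c i \<restriction> U \<in> vfields T A U" for i
    using coord_vfield_in_vfields[OF c] U(2) by (rule vfields_vrestrict)
  have comp: "component c Y i \<in> smooth_functions T A U" for i
    using c Y U by (rule component_smooth)
  have "F Y = F (\<Sum>i\<in>UNIV. component c Y i \<cdot>\<^sub>v (coord_vfield T A c i \<restriction> U))"
    using vfield_expansion[OF c Y U(2)] by (rule arg_cong)
  also have "\<dots> = (\<Sum>i\<in>UNIV. component c Y i \<cdot>\<^sub>v F (coord_vfield T A c i \<restriction> U))"
    by (simp add: sum scale vfields_fscale e comp)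
  finally show ?thesis .
qed

end

section \<open>F-manifolds with compatible connection\<close>

locale compatible_F_manifold =
  fixes T :: "'a topology" and A :: "('a, 'n::finite) chart set" and m nabla :: "'a vop"
  assumes F_manifold: "F_manifold_compatible_connection T A m nabla"

sublocale compatible_F_manifold \<subseteq> smooth_atlas T A
  using F_manifold by unfold_locales (simp add: F_manifold_compatible_connection_def)

context compatible_F_manifold
begin

context
  fixes U assumes U: "openin T U"
begin

lemma product_on:
  assumes "X \<in> vfields T A U" "Y \<in> vfields T A U"
  shows m_closed: "m U X Y \<in> vfields T A U"
    and m_restrict: "openin T V \<Longrightarrow> V \<subseteq> U \<Longrightarrow> m V (X \<restriction> V) (Y \<restriction> V) = m U X Y \<restriction> V"
    and m_commute: "m U X Y = m U Y X"
    and m_associative: "Z \<in> vfields T A U \<Longrightarrow> m U (m U X Y) Z = m U X (m U Y Z)"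
    and m_add_left: "Z \<in> vfields T A U \<Longrightarrow> m U (X + Y) Z = m U X Z + m U Y Z"
    and m_add_right: "Z \<in> vfields T A U \<Longrightarrow> m U X (Y + Z) = m U X Y + m U X Z"
    and m_fscale_left: "f \<in> smooth_functions T A U \<Longrightarrow> m U (f \<cdot>\<^sub>v X) Y = f \<cdot>\<^sub>v m U X Y"
    and m_fscale_right: "f \<in> smooth_functions T A U \<Longrightarrow> m U X (f \<cdot>\<^sub>v Y) = f \<cdot>\<^sub>v m U X Y"
proof -
  have "comm_assoc_product T A m"
    using F_manifold by (simp add: F_manifold_compatible_connection_def)
  then have local: "local_operation T A m"
    and axioms: "\<And>Z f. Z \<in> vfields T A U \<Longrightarrow> f \<in> smooth_functions T A U \<Longrightarrow>
      m U X Y = m U Y X \<and> m U (m U X Y) Z = m U X (m U Y Z) \<and>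
      m U (X + Y) Z = m U X Z + m U Y Z \<and> m U X (Y + Z) = m U X Y + m U X Z \<and>
      m U (f \<cdot>\<^sub>v X) Y = f \<cdot>\<^sub>v m U X Y \<and> m U X (f \<cdot>\<^sub>v Y) = f \<cdot>\<^sub>v m U X Y"
    unfolding comm_assoc_product_def using U assms by blast+
  show "m U X Y \<in> vfields T A U"
    and "openin T V \<Longrightarrow> V \<subseteq> U \<Longrightarrow> m V (X \<restriction> V) (Y \<restriction> V) = m U X Y \<restriction> V"
    using local U assms unfolding local_operation_def by blast+
  note const = smooth_functions_const[OF U, of 1]
  show "m U X Y = m U Y X"
    using axioms[OF assms(1) const] by blast
  show "m U (m U X Y) Z = m U X (m U Y Z)" "m U (X + Y) Z = m U X Z + m U Y Z"
    "m U X (Y + Z) = m U X Y + m U X Z" if "Z \<in> vfields T A U"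
    using axioms[OF that const] by blast+
  show "m U (f \<cdot>\<^sub>v X) Y = f \<cdot>\<^sub>v m U X Y" "m U X (f \<cdot>\<^sub>v Y) = f \<cdot>\<^sub>v m U X Y"
    if "f \<in> smooth_functions T A U"
    using axioms[OF assms(1) that] by blast+
qed

lemma connection_on:
  assumes "X \<in> vfields T A U" "Y \<in> vfields T A U"
  shows nabla_closed: "nabla U X Y \<in> vfields T A U"
    and nabla_restrict: "openin T V \<Longrightarrow> V \<subseteq> U \<Longrightarrow> nabla V (X \<restriction> V) (Y \<restriction> V) = nabla U X Y \<restriction> V"
    and nabla_add_left: "Z \<in> vfields T A U \<Longrightarrow> nabla U (X + Y) Z = nabla U X Z + nabla U Y Z"
    and nabla_add_right: "Z \<in> vfields T A U \<Longrightarrow> nabla U X (Y + Z) = nabla U X Y + nabla U X Z"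
    and nabla_fscale_left: "f \<in> smooth_functions T A U \<Longrightarrow> nabla U (f \<cdot>\<^sub>v X) Y = f \<cdot>\<^sub>v nabla U X Y"
    and nabla_leibniz: "f \<in> smooth_functions T A U \<Longrightarrow>
      nabla U X (f \<cdot>\<^sub>v Y) = vapply X f \<cdot>\<^sub>v Y + f \<cdot>\<^sub>v nabla U X Y"
proof -
  have "connection T A nabla"
    using F_manifold by (simp add: F_manifold_compatible_connection_def)
  then have local: "local_operation T A nabla"
    and axioms: "\<And>Z f. Z \<in> vfields T A U \<Longrightarrow> f \<in> smooth_functions T A U \<Longrightarrow>
      nabla U (X + Y) Z = nabla U X Z + nabla U Y Z \<and> nabla U X (Y + Z) = nabla U X Y + nabla U X Z \<and>
      nabla U (f \<cdot>\<^sub>v X) Y = f \<cdot>\<^sub>v nabla U X Y \<and>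
      nabla U X (f \<cdot>\<^sub>v Y) = vapply X f \<cdot>\<^sub>v Y + f \<cdot>\<^sub>v nabla U X Y"
    unfolding connection_def using U assms by blast+
  show "nabla U X Y \<in> vfields T A U"
    and "openin T V \<Longrightarrow> V \<subseteq> U \<Longrightarrow> nabla V (X \<restriction> V) (Y \<restriction> V) = nabla U X Y \<restriction> V"
    using local U assms unfolding local_operation_def by blast+
  note const = smooth_functions_const[OF U, of 1]
  show "nabla U (X + Y) Z = nabla U X Z + nabla U Y Z" "nabla U X (Y + Z) = nabla U X Y + nabla U X Z"
    if "Z \<in> vfields T A U"
    using axioms[OF that const] by blast+
  show "nabla U (f \<cdot>\<^sub>v X) Y = f \<cdot>\<^sub>v nabla U X Y"
    "nabla U X (f \<cdot>\<^sub>v Y) = vapply X f \<cdot>\<^sub>v Y + f \<cdot>\<^sub>v nabla U X Y"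
    if "f \<in> smooth_functions T A U"
    using axioms[OF assms(1) that] by blast+
qed

lemma compatible_connection_algebra:
  "compatible_connection_algebra (vfields T A U) (m U) (nabla U) (lie_bracket T A)"
proof
  fix X Y Z assume XYZ: "X \<in> vfields T A U" "Y \<in> vfields T A U" "Z \<in> vfields T A U"
  show "nabla U X Y - nabla U Y X = lie_bracket T A X Y"
    using F_manifold U XYZ unfolding F_manifold_compatible_connection_def torsionless_def by blast
  show "nabla U X (m U Y Z) - m U (nabla U X Y) Z - m U Y (nabla U X Z) =
      nabla U Y (m U X Z) - m U (nabla U Y X) Z - m U X (nabla U Y Z)"
    using F_manifold U XYZ
    unfolding F_manifold_compatible_connection_def compatible_with_product_def deriv_product_def
    by blast
qed (rule vfields_add vfields_diff m_closed nabla_closed m_commute m_associative m_add_right;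
  (assumption | rule U))+

lemma curvature:
  assumes "X \<in> vfields T A U" "Y \<in> vfields T A U" "Z \<in> vfields T A U" "W \<in> vfields T A U"
  shows "riemann T A nabla U Y Z (m U X W) + riemann T A nabla U X Y (m U Z W)
    + riemann T A nabla U Z X (m U Y W) = 0"
  using F_manifold U assms
  unfolding F_manifold_compatible_connection_def curvature_condition_def by blast

end

end

section \<open>The coordinate condition in invariant form\<close>

locale twisting_vfield = compatible_F_manifold T A m nabla
  for T :: "'a topology" and A :: "('a, 'n::finite) chart set" and m nabla :: "'a vop" +
  fixes P :: "'a vfield"
  assumes invertible: "invertible_vfield T A m P"
    and coordinate_symmetry: "c \<in> A \<Longrightarrow> p \<in> fst c \<Longrightarrow>
      (\<Sum>l\<in>UNIV. structure_const T A m c i j l p * cov_deriv_component T A nabla c P k l p) =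
      (\<Sum>l\<in>UNIV. structure_const T A m c i k l p * cov_deriv_component T A nabla c P j l p)"
begin

abbreviation Q :: "'a vfield" where
  "Q \<equiv> inverse_vfield T A m P"

lemma P_in_vfields: "P \<in> vfields T A (topspace T)"
  using invertible by (simp add: invertible_vfield_def)

text \<open>The usual argument for monoids: \<open>Y = (P Z) Y = Z (P Y) = Z\<close>.\<close>

lemma inverse_vfield_unique:
  assumes "is_inverse_vfield T A m P Y" and "is_inverse_vfield T A m P Z"
  shows "Y = Z"
proof -
  let ?S = "topspace T"
  have S: "openin T ?S" by simp
  have YZ: "Y \<in> vfields T A ?S" "Z \<in> vfields T A ?S"
    using assms by (auto simp: is_inverse_vfield_def)
  have unit: "m ?S (m ?S P W) X = X"
    if "is_inverse_vfield T A m P W" "X \<in> vfields T A ?S" for W X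
  proof -
    have "m ?S (m ?S P W \<restriction> ?S) X = X"
      using that S unfolding is_inverse_vfield_def unit_vfield_def by blast
    moreover have "m ?S P W \<restriction> ?S = m ?S P W"
      using that by (intro vrestrict_self) (simp add: is_inverse_vfield_def unit_vfield_def)
    ultimately show ?thesis
      by simp
  qed
  have "Y = m ?S (m ?S P Z) Y"
    using unit[OF assms(2) YZ(1)] by simp
  also have "\<dots> = m ?S (m ?S Z P) Y"
    using m_commute[OF S P_in_vfields YZ(2)] by simp
  also have "\<dots> = m ?S Z (m ?S P Y)"
    by (intro m_associative S YZ P_in_vfields)
  also have "\<dots> = m ?S (m ?S P Y) Z"
    by (intro m_commute m_closed S YZ P_in_vfields)
  also have "\<dots> = Z"
    using unit[OF assms(1) YZ(2)] .
  finally show ?thesis .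
qed

lemma is_inverse_Q: "is_inverse_vfield T A m P Q"
proof -
  obtain Y where Y: "is_inverse_vfield T A m P Y"
    using invertible unfolding invertible_vfield_def by blast
  show ?thesis
    unfolding inverse_vfield_def
    by (rule theI[where P = "is_inverse_vfield T A m P", OF Y inverse_vfield_unique[OF _ Y]])
qed

lemma Q_in_vfields: "Q \<in> vfields T A (topspace T)"
  using is_inverse_Q by (simp add: is_inverse_vfield_def)

lemma P_restrict: "openin T U \<Longrightarrow> P \<restriction> U \<in> vfields T A U"
  using P_in_vfields openin_subset by (rule vfields_vrestrict)

lemma Q_restrict: "openin T U \<Longrightarrow> Q \<restriction> U \<in> vfields T A U"
  using Q_in_vfields openin_subset by (rule vfields_vrestrict)

lemma P_Q_unit:
  assumes U: "openin T U" and Y: "Y \<in> vfields T A U"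
  shows "m U (m U (P \<restriction> U) (Q \<restriction> U)) Y = Y"
proof -
  have "m U (P \<restriction> U) (Q \<restriction> U) = m (topspace T) P Q \<restriction> U"
    by (intro m_restrict P_in_vfields Q_in_vfields U openin_subset openin_topspace)
  then show ?thesis
    using is_inverse_Q U Y by (simp add: is_inverse_vfield_def unit_vfield_def)
qed

text \<open>The two sides of the coordinate condition are the components of the two products here, because
  the product with \<open>\<partial>\<^sub>j\<close> is function-linear and its values on the coordinate fields have the structure
  constants as components.\<close>

lemma coordinate_fields_symmetry:
  assumes c: "c \<in> A"
  shows "m (fst c) (coord_vfield T A c j) (nabla (fst c) (coord_vfield T A c k) (P \<restriction> fst c))
    = m (fst c) (coord_vfield T A c k) (nabla (fst c) (coord_vfield T A c j) (P \<restriction> fst c))"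
    (is "?L j k = ?L k j")
proof -
  let ?V = "fst c" and ?e = "coord_vfield T A c"
  have V: "openin T ?V"
    using is_chart_of_atlas(1)[OF c] .
  have e: "?e i \<in> vfields T A ?V" "?e i \<restriction> ?V = ?e i" for i
    using coord_vfield_in_vfields[OF c] vrestrict_self by blast+
  have D: "nabla ?V (?e i) (P \<restriction> ?V) \<in> vfields T A ?V" for i
    by (intro nabla_closed V e P_restrict)
  have comp: "component c (?L j k) i p =
      (\<Sum>l\<in>UNIV. structure_const T A m c i j l p * cov_deriv_component T A nabla c P k l p)"
    for i j k p
  proof -
    have "?L j k = (\<Sum>l\<in>UNIV. component c (nabla ?V (?e k) (P \<restriction> ?V)) l \<cdot>\<^sub>v m ?V (?e j) (?e l \<restriction> ?V))"
      by (rule tensor_expansion[where F = "m ?V (?e j)", OF c V order_refl D])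
        (auto intro: m_add_right m_fscale_right V e)
    then show ?thesis
      by (simp add: component_sum component_fscale e structure_const_def cov_deriv_component_def
          mult.commute)
  qed
  have L: "?L j k \<in> vfields T A ?V" for j k
    by (intro m_closed V e D)
  \<comment> \<open>The hypothesis covers only the points of the chart domain; elsewhere the fields are \<open>0\<close> by
    convention.\<close>
  have "component c (?L j k) i p = component c (?L k j) i p" for i p
  proof (cases "p \<in> ?V")
    case True
    then show ?thesis
      unfolding comp by (rule coordinate_symmetry[OF c])
  next
    case False
    then show ?thesis
      using vfields_zero_outside[OF L] by (simp add: component_def vapply_def)
  qed
  then have "component c (?L j k) = component c (?L k j)"
    by (intro ext)
  then show ?thesis
    using vfield_expansion[OF c L[of j k] order_refl] vfield_expansion[OF c L[of k j] order_refl]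
    by metis
qed

text \<open>The expression \<open>Y \<circ> \<nabla>\<^sub>Z P\<close> is function-linear in \<open>Y\<close> and in the direction \<open>Z\<close>, so its
  symmetry needs to be known only for coordinate fields.\<close>

lemma chart_symmetry:
  assumes c: "c \<in> A" and U: "openin T U" "U \<subseteq> fst c"
    and Y: "Y \<in> vfields T A U" and Z: "Z \<in> vfields T A U"
  shows "m U Y (nabla U Z (P \<restriction> U)) = m U Z (nabla U Y (P \<restriction> U))"
proof -
  let ?e = "\<lambda>i. coord_vfield T A c i \<restriction> U"
  have e: "?e i \<in> vfields T A U" for i
    by (rule vfields_vrestrict[OF coord_vfield_in_vfields[OF c] U(2)])
  define B where "B = (\<lambda>Y Z. m U Y (nabla U Z (P \<restriction> U)))"
  have left: "B Y Z = (\<Sum>i\<in>UNIV. component c Y i \<cdot>\<^sub>v B (?e i) Z)"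
    if "Y \<in> vfields T A U" "Z \<in> vfields T A U" for Y Z
    by (rule tensor_expansion[where F = "\<lambda>Y. B Y Z", OF c U that(1)])
      (simp_all add: B_def that m_add_left m_fscale_left nabla_closed P_restrict U)
  have right: "B Y Z = (\<Sum>i\<in>UNIV. component c Z i \<cdot>\<^sub>v B Y (?e i))"
    if "Y \<in> vfields T A U" "Z \<in> vfields T A U" for Y Z
    by (rule tensor_expansion[where F = "B Y", OF c U that(2)])
      (simp_all add: B_def that m_add_right m_fscale_right nabla_add_left nabla_fscale_left
        nabla_closed P_restrict U)
  have ee: "B (?e i) (?e j) = B (?e j) (?e i)" for i j
  proof -
    have V: "openin T (fst c)"
      using is_chart_of_atlas(1)[OF c] .
    have "B (?e i) (?e j) = m (fst c) (coord_vfield T A c i)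
        (nabla (fst c) (coord_vfield T A c j) (P \<restriction> fst c)) \<restriction> U" for i j
      unfolding B_def
      using m_restrict[OF V coord_vfield_in_vfields[OF c, of i]
          nabla_closed[OF V coord_vfield_in_vfields[OF c, of j] P_restrict[OF V]] U]
        nabla_restrict[OF V coord_vfield_in_vfields[OF c, of j] P_restrict[OF V] U]
      by (simp add: vrestrict_vrestrict U)
    then show ?thesis
      using coordinate_fields_symmetry[OF c, of i j] by simp
  qed
  have eZ: "B (?e i) Z = B Z (?e i)" for i
    using left[OF Z e] right[OF e Z] ee by simp
  have "B Y Z = B Z Y"
    using left[OF Y Z] right[OF Z Y] eZ by simp
  then show ?thesis
    by (simp add: B_def)
qed

text \<open>An open set need not lie in a chart domain. The identity is checked at each point after
  restriction to a chart around it, with which the product and the connection commute.\<close>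

lemma product_nabla_symmetry:
  assumes U: "openin T U" and Y: "Y \<in> vfields T A U" and Z: "Z \<in> vfields T A U"
  shows "m U Y (nabla U Z (P \<restriction> U)) = m U Z (nabla U Y (P \<restriction> U))"
proof (rule vfields_eqI)
  show "m U Y (nabla U Z (P \<restriction> U)) \<in> vfields T A U" "m U Z (nabla U Y (P \<restriction> U)) \<in> vfields T A U"
    by (intro m_closed nabla_closed U Y Z P_restrict)+
  fix p assume p: "p \<in> U"
  obtain c where c: "c \<in> A" "p \<in> fst c"
    using ex_chart p openin_subset[OF U] by blast
  let ?W = "U \<inter> fst c"
  have W: "openin T ?W" "?W \<subseteq> U" "?W \<subseteq> fst c"
    using U is_chart_of_atlas(1)[OF c(1)] by auto
  have restr: "m U Y (nabla U Z (P \<restriction> U)) \<restriction> ?W = m ?W (Y \<restriction> ?W) (nabla ?W (Z \<restriction> ?W) (P \<restriction> ?W))"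
    if Y: "Y \<in> vfields T A U" and Z: "Z \<in> vfields T A U" for Y Z
    using m_restrict[OF U Y nabla_closed[OF U Z P_restrict[OF U]] W(1,2)]
      nabla_restrict[OF U Z P_restrict[OF U] W(1,2)]
    by (simp add: vrestrict_vrestrict)
  have "m U Y (nabla U Z (P \<restriction> U)) \<restriction> ?W = m U Z (nabla U Y (P \<restriction> U)) \<restriction> ?W"
    unfolding restr[OF Y Z] restr[OF Z Y]
    by (intro chart_symmetry[OF c(1) W(1,3)] vfields_vrestrict[OF _ W(2)] Y Z)
  from fun_cong[OF this, of p] show "m U Y (nabla U Z (P \<restriction> U)) p = m U Z (nabla U Y (P \<restriction> U)) p"
    using p c(2) by (simp add: vrestrict_apply)
qed

section \<open>The twisted connection\<close>

lemma twisting_algebra: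
  assumes U: "openin T U"
  shows "twisting_algebra (vfields T A U) (m U) (nabla U) (lie_bracket T A) (P \<restriction> U) (Q \<restriction> U)"
proof -
  interpret compatible_connection_algebra "vfields T A U" "m U" "nabla U" "lie_bracket T A"
    by (rule compatible_connection_algebra[OF U])
  show ?thesis
    by unfold_locales (rule P_restrict Q_restrict P_Q_unit product_nabla_symmetry; (assumption | rule U))+
qed

abbreviation nabla' :: "'a vop" where
  "nabla' \<equiv> twisted_connection T A m nabla P"

lemma twisted_connection_eq:
  assumes U: "openin T U"
  shows "nabla' U = twisting_algebra.twisted (m U) (nabla U) (P \<restriction> U) (Q \<restriction> U)"
  using twisting_algebra.twisted_def[OF twisting_algebra[OF U]]
  by (simp add: twisted_connection_def fun_eq_iff)

lemma local_operation_twisted: "local_operation T A nabla'"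
  unfolding local_operation_def
proof (intro allI impI ballI conjI)
  fix U Y Z
  assume U: "openin T U" and Y: "Y \<in> vfields T A U" and Z: "Z \<in> vfields T A U"
  have mZ: "m U (P \<restriction> U) Z \<in> vfields T A U"
    by (intro m_closed U Z P_restrict)
  have D: "nabla U Y (m U (P \<restriction> U) Z) \<in> vfields T A U"
    by (intro nabla_closed U Y mZ)
  show "nabla' U Y Z \<in> vfields T A U"
    unfolding twisted_connection_def by (intro m_closed U Q_restrict D)
  fix V assume V: "openin T V \<and> V \<subseteq> U"
  then show "nabla' V (Y \<restriction> V) (Z \<restriction> V) = nabla' U Y Z \<restriction> V"
    using m_restrict[OF U P_restrict[OF U] Z, of V] nabla_restrict[OF U Y mZ, of V]
      m_restrict[OF U Q_restrict[OF U] D, of V]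
    by (simp add: twisted_connection_def vrestrict_vrestrict)
qed

text \<open>In the Leibniz rule, the term with the derivative of \<open>f\<close> comes out as it should because there
  \<open>Q\<close> and \<open>P\<close> cancel.\<close>

lemma connection_twisted: "connection T A nabla'"
  unfolding connection_def
proof (intro conjI allI impI ballI local_operation_twisted)
  fix U X Y Z f
  assume U: "openin T U" and X: "X \<in> vfields T A U" and Y: "Y \<in> vfields T A U"
    and Z: "Z \<in> vfields T A U" and f: "f \<in> smooth_functions T A U"
  interpret twisting_algebra "vfields T A U" "m U" "nabla U" "lie_bracket T A" "P \<restriction> U" "Q \<restriction> U"
    by (rule twisting_algebra[OF U])
  note closed = U X Y Z f p q m_closed D_closed
  show "nabla' U (X + Y) Z = nabla' U X Z + nabla' U Y Z"
    by (simp add: twisted_connection_def nabla_add_left m_add_right closed)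
  show "nabla' U X (Y + Z) = nabla' U X Y + nabla' U X Z"
    by (simp add: twisted_connection_def nabla_add_right m_add_right closed)
  show "nabla' U (f \<cdot>\<^sub>v X) Y = f \<cdot>\<^sub>v nabla' U X Y"
    by (simp add: twisted_connection_def nabla_fscale_left m_fscale_right closed)
  show "nabla' U X (f \<cdot>\<^sub>v Y) = vapply X f \<cdot>\<^sub>v Y + f \<cdot>\<^sub>v nabla' U X Y"
    by (simp add: twisted_connection_def nabla_leibniz m_add_right m_fscale_right closed
        vapply_smooth vfields_fscale q_p_cancel)
qed

lemma torsionless_twisted: "torsionless T A nabla'"
  unfolding torsionless_def
proof (intro allI impI ballI)
  fix U Y Z
  assume U: "openin T U" and YZ: "Y \<in> vfields T A U" "Z \<in> vfields T A U"
  show "nabla' U Y Z - nabla' U Z Y = lie_bracket T A Y Z"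
    unfolding twisted_connection_eq[OF U]
    by (rule twisting_algebra.twisted_torsion[OF twisting_algebra[OF U] YZ])
qed

lemma compatible_twisted: "compatible_with_product T A m nabla'"
  unfolding compatible_with_product_def
proof (intro allI impI ballI conjI)
  fix U X Y Z
  assume U: "openin T U" and XYZ: "X \<in> vfields T A U" "Y \<in> vfields T A U" "Z \<in> vfields T A U"
  show "deriv_product m nabla' U X Y Z = deriv_product m nabla' U Y X Z"
    unfolding deriv_product_def twisted_connection_eq[OF U]
    by (rule twisting_algebra.twisted_compatible[OF twisting_algebra[OF U] XYZ])
  show "deriv_product m nabla' U X Y Z = deriv_product m nabla' U X Z Y"
    unfolding deriv_product_def twisted_connection_eq[OF U]
    by (rule twisting_algebra.twisted_deriv_product_commute[OF twisting_algebra[OF U] XYZ])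
qed

lemma curvature_twisted: "curvature_condition T A m nabla'"
  unfolding curvature_condition_def
proof (intro allI impI ballI)
  fix U X Y Z W
  assume U: "openin T U" and XYZW: "X \<in> vfields T A U" "Y \<in> vfields T A U" "Z \<in> vfields T A U"
    "W \<in> vfields T A U"
  show "riemann T A nabla' U Y Z (m U X W) + riemann T A nabla' U X Y (m U Z W)
      + riemann T A nabla' U Z X (m U Y W) = 0"
    by (rule twisting_algebra.twisted_curvature[where R = "riemann T A nabla U"
          and R' = "riemann T A nabla' U", OF twisting_algebra[OF U] _ _ _ XYZW])
      ((rule curvature[OF U]; assumption),
        simp_all only: riemann_def twisted_connection_eq[OF U])
qed

lemma F_manifold_twisted: "F_manifold_compatible_connection T A m nabla'"
  using F_manifold connection_twisted torsionless_twisted compatible_twisted curvature_twisted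
  by (simp add: F_manifold_compatible_connection_def)

end

theorem theorem6p2:
  fixes T :: "'a topology" and A :: "('a, 'n::finite) chart set"
    and m nabla :: "'a vop" and X :: "'a vfield"
  assumes "F_manifold_compatible_connection T A m nabla"
    and "invertible_vfield T A m X"
    and "\<And>c p i j k. c \<in> A \<Longrightarrow> p \<in> fst c \<Longrightarrow>
      (\<Sum>l\<in>UNIV. structure_const T A m c i j l p * cov_deriv_component T A nabla c X k l p) =
      (\<Sum>l\<in>UNIV. structure_const T A m c i k l p * cov_deriv_component T A nabla c X j l p)"
  shows "F_manifold_compatible_connection T A m (twisted_connection T A m nabla X)"
proof -
  interpret twisting_vfield T A m nabla X
    using assms by unfold_locales
  show ?thesis
    by (rule F_manifold_twisted)
qed

end
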